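(* Let $n\geq 1$ and let $X_1,X_2,\ldots,X_n$ be non-degenerate independent random variables (not necessarily identically distributed) taking values in a measurable space $(F,\mathcal{F})$. Fix a point $\partial\notin F$. Let $T$ be a random subset of $[n]=\{1,2,\ldots,n\}$ that is independent of $(X_1,X_2,\ldots,X_n)$. For $i=1,\ldots,n$ define $Y_i=X_i$ if $i\in T$ and $Y_i=\partial$ otherwise. Then \[R\big((X_1,X_2,\ldots,X_n),(Y_1,Y_2,\ldots,Y_n)\big)=\sqrt{\max\{P(i\in T):i\in[n]\}}.\]
   Context: For two random elements $X,Y$ (defined on a common probability space, with values in arbitrary measurable spaces), the maximal correlation coefficient is $R(X,Y)=\sup \rho(\varphi(X),\psi(Y))$, where $\rho$ denotes the Pearson correlation coefficient and the supremum is over all real-valued measurable functions $\varphi,\psi$ such that $\varphi(X)$ and $\psi(Y)$ are square-integrable with positive variance. A random element $X$ is degenerate if every real-valued measurable function of it is almost surely constant, and non-degenerate otherwise (equivalently, there is a measurable set $A$ with $0<P(X\in A)<1$). If $X$ or $Y$ is degenerate, one sets $R(X,Y)=0$. The space $F\cup\{\partial\}$ carries the $\sigma$-field generated by $\mathcal{F}$ and $\{\partial\}$. *)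

theory Defs
  imports "HOL-Probability.Probability"
begin

context prob_space
begin

definition covariance :: "('a \<Rightarrow> real) \<Rightarrow> ('a \<Rightarrow> real) \<Rightarrow> real" where
  "covariance U V = expectation (\<lambda>\<omega>. (U \<omega> - expectation U) * (V \<omega> - expectation V))"

definition pearson_correlation :: "('a \<Rightarrow> real) \<Rightarrow> ('a \<Rightarrow> real) \<Rightarrow> real" where
  "pearson_correlation U V = covariance U V / (sqrt (variance U) * sqrt (variance V))"

definition degenerate :: "'b measure \<Rightarrow> ('a \<Rightarrow> 'b) \<Rightarrow> bool" where
  "degenerate S X \<longleftrightarrow> (\<forall>f \<in> borel_measurable S. \<exists>c::real. AE \<omega> in M. f (X \<omega>) = c)"

definition correlation_test_functions :: "'b measure \<Rightarrow> ('a \<Rightarrow> 'b) \<Rightarrow> ('b \<Rightarrow> real) set" where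
  "correlation_test_functions S X =
     {\<phi> \<in> borel_measurable S.
        integrable M (\<lambda>\<omega>. (\<phi> (X \<omega>))\<^sup>2) \<and> variance (\<lambda>\<omega>. \<phi> (X \<omega>)) > 0}"

text \<open>The supremum of reals below is a genuine one: by the Cauchy-Schwarz inequality the
  correlations lie in the interval from -1 to 1, and if neither X nor Y is degenerate, then
  indicator functions provide admissible \<open>\<phi>\<close> and \<open>\<psi>\<close>.\<close>

definition maximal_correlation ::
    "'b measure \<Rightarrow> ('a \<Rightarrow> 'b) \<Rightarrow> 'c measure \<Rightarrow> ('a \<Rightarrow> 'c) \<Rightarrow> real" where
  "maximal_correlation S X S' Y =
     (if degenerate S X \<or> degenerate S' Y then 0
      else (SUP (\<phi>, \<psi>) \<in> correlation_test_functions S X \<times> correlation_test_functions S' Y.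
              pearson_correlation (\<lambda>\<omega>. \<phi> (X \<omega>)) (\<lambda>\<omega>. \<psi> (Y \<omega>))))"

text \<open>The library's \<open>indep_var\<close> forces both random elements to take values in the same type,
  which a random set and a random vector do not. The families of preimages below are already
  sigma-algebras, so \<open>indep_set\<close> can be applied to them directly.\<close>

definition indep_elements ::
    "'b measure \<Rightarrow> ('a \<Rightarrow> 'b) \<Rightarrow> 'c measure \<Rightarrow> ('a \<Rightarrow> 'c) \<Rightarrow> bool" where
  "indep_elements S X S' Y \<longleftrightarrow>
     random_variable S X \<and> random_variable S' Y \<and>
     indep_set {X -` A \<inter> space M | A. A \<in> sets S} {Y -` B \<inter> space M | B. B \<in> sets S'}"

end

text \<open>The space F with an extra point adjoined: \<open>None\<close> is the extra point and \<open>Some\<close> embeds F,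
  so that the point lies outside F for every F, also when F fills its whole type.\<close>

definition adjoin_point :: "'b measure \<Rightarrow> 'b option measure" where
  "adjoin_point F = sigma (insert None (Some ` space F)) (insert {None} ((`) Some ` sets F))"

end

theory Submission
  imports Defs
begin

text \<open>Condition on the random set: on the event \<open>T = t\<close> the masked vector is a function of the
  coordinates in \<open>t\<close>, so a test function of it splits into square-integrable functions \<open>g\<^sub>t\<close>
  with weights \<open>P(T = t)\<close>, and its covariance with a centred \<open>f\<close> is the weighted sum of the
  inner products of \<open>f\<close> and \<open>g\<^sub>t\<close>. Averaging out one coordinate \<open>i\<close> after the other is an
  orthogonal projection that splits each inner product into martingale-difference parts; the
  \<open>i\<close>-th part of \<open>g\<^sub>t\<close> vanishes unless \<open>i \<in> t\<close>. By the Cauchy-Schwarz inequality the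
  \<open>i\<close>-th parts therefore contribute a factor of at most the square root of \<open>P(i \<in> T)\<close>. The
  bound is attained by a centred function of a single coordinate maximising \<open>P(i \<in> T)\<close>, set
  to zero at the extra point.\<close>

subsection \<open>Square-integrable functions\<close>

lemma integrable_mult_of_square_integrable:
  fixes f g :: "'a \<Rightarrow> real"
  assumes [measurable]: "f \<in> borel_measurable N" "g \<in> borel_measurable N"
    and "integrable N (\<lambda>x. (f x)\<^sup>2)" "integrable N (\<lambda>x. (g x)\<^sup>2)"
  shows "integrable N (\<lambda>x. f x * g x)"
proof (rule Bochner_Integration.integrable_bound)
  show "integrable N (\<lambda>x. (f x)\<^sup>2 + (g x)\<^sup>2)" using assms by simp
  show "AE x in N. norm (f x * g x) \<le> norm ((f x)\<^sup>2 + (g x)\<^sup>2)"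
  proof (rule AE_I2)
    fix x
    have "2 * (\<bar>f x\<bar> * \<bar>g x\<bar>) \<le> \<bar>f x\<bar>\<^sup>2 + \<bar>g x\<bar>\<^sup>2"
      using sum_squares_bound[of "\<bar>f x\<bar>" "\<bar>g x\<bar>"] by simp
    moreover have "0 \<le> \<bar>f x\<bar> * \<bar>g x\<bar>" by simp
    ultimately have "\<bar>f x\<bar> * \<bar>g x\<bar> \<le> (f x)\<^sup>2 + (g x)\<^sup>2" unfolding power2_abs by linarith
    then show "norm (f x * g x) \<le> norm ((f x)\<^sup>2 + (g x)\<^sup>2)" by (simp add: abs_mult)
  qed
qed simp

text \<open>Expanding the square leaves a mixed term, whose integrability is the preceding
  lemma.\<close>

lemma integrable_square_add:
  fixes f g :: "'a \<Rightarrow> real"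
  assumes [measurable]: "f \<in> borel_measurable N" "g \<in> borel_measurable N"
    and "integrable N (\<lambda>x. (f x)\<^sup>2)" "integrable N (\<lambda>x. (g x)\<^sup>2)"
  shows "integrable N (\<lambda>x. (f x + g x)\<^sup>2)"
  using assms integrable_mult_of_square_integrable[OF assms]
  by (simp add: power2_sum mult.assoc)

lemma integrable_square_diff:
  fixes f g :: "'a \<Rightarrow> real"
  assumes [measurable]: "f \<in> borel_measurable N" "g \<in> borel_measurable N"
    and "integrable N (\<lambda>x. (f x)\<^sup>2)" "integrable N (\<lambda>x. (g x)\<^sup>2)"
  shows "integrable N (\<lambda>x. (f x - g x)\<^sup>2)"
  using integrable_square_add[of f N "\<lambda>x. - g x"] assms by simp

text \<open>Cauchy-Schwarz for an arbitrary measure: the integral of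
  \<open>(s * f x - t * g x)\<^sup>2\<close> is a nonnegative quadratic form in \<open>s\<close> and
  \<open>t\<close>, so its discriminant cannot be positive.\<close>

lemma square_integral_mult_le:
  fixes f g :: "'a \<Rightarrow> real"
  assumes [measurable]: "f \<in> borel_measurable N" "g \<in> borel_measurable N"
    and f: "integrable N (\<lambda>x. (f x)\<^sup>2)" and g: "integrable N (\<lambda>x. (g x)\<^sup>2)"
  shows "(\<integral>x. f x * g x \<partial>N)\<^sup>2 \<le> (\<integral>x. (f x)\<^sup>2 \<partial>N) * (\<integral>x. (g x)\<^sup>2 \<partial>N)"
proof -
  define a b c where "a = (\<integral>x. (f x)\<^sup>2 \<partial>N)" and "b = (\<integral>x. (g x)\<^sup>2 \<partial>N)" and "c = (\<integral>x. f x * g x \<partial>N)"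
  have fg: "integrable N (\<lambda>x. f x * g x)"
    by (rule integrable_mult_of_square_integrable) fact+
  have ab: "0 \<le> a" "0 \<le> b" by (simp_all add: a_def b_def)
  have quad: "0 \<le> s\<^sup>2 * a - 2 * (s * t) * c + t\<^sup>2 * b" for s t :: real
  proof -
    have "0 \<le> (\<integral>x. (s * f x - t * g x)\<^sup>2 \<partial>N)" by simp
    also have "\<dots> = (\<integral>x. s\<^sup>2 * (f x)\<^sup>2 - 2 * (s * t) * (f x * g x) + t\<^sup>2 * (g x)\<^sup>2 \<partial>N)"
      by (intro Bochner_Integration.integral_cong refl) (simp add: power2_eq_square algebra_simps)
    also have "\<dots> = s\<^sup>2 * a - 2 * (s * t) * c + t\<^sup>2 * b"
      using f g fg by (simp add: a_def b_def c_def)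
    finally show ?thesis .
  qed
  have "c\<^sup>2 \<le> a * b"
  proof (cases "a = 0")
    case True
    have "0 \<le> - 2 * s * c + b" for s using quad[of s 1] True by simp
    \<comment> \<open>For \<open>a = 0\<close> the form is affine in \<open>s\<close>; if
      \<open>c\<close> were nonzero, this choice of \<open>s\<close> would give it the value
      -1.\<close>
    from this[of "(b + 1) / (2 * c)"] have "c = 0" by (cases "c = 0") (auto simp: field_simps)
    then show ?thesis using True by simp
  next
    case False
    then have "a > 0" using ab by simp
    \<comment> \<open>The form is minimal in the direction \<open>s / t = c / a\<close>; taking
      \<open>s = c\<close> and \<open>t = a\<close> avoids the division.\<close>
    have "0 \<le> a * (a * b - c\<^sup>2)" using quad[of c a] by (simp add: power2_eq_square algebra_simps)
    then show ?thesis using \<open>a > 0\<close> by (simp add: zero_le_mult_iff)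
  qed
  then show ?thesis by (simp add: a_def b_def c_def)
qed

text \<open>Cauchy-Schwarz for two vectors of the plane with squared entries \<open>v\<close>,
  \<open>v'\<close> and \<open>w\<close>, \<open>w'\<close>. The mixed term \<open>2 * a * b\<close>
  is controlled by the inequality of arithmetic and geometric means for \<open>v * w'\<close> and
  \<open>v' * w\<close>. It later joins the bounds for two orthogonal parts.\<close>

lemma add_square_le:
  fixes a b :: real
  assumes "a\<^sup>2 \<le> v * w" "b\<^sup>2 \<le> v' * w'" "0 \<le> v" "0 \<le> w" "0 \<le> v'" "0 \<le> w'"
  shows "(a + b)\<^sup>2 \<le> (v + v') * (w + w')"
proof -
  have "(a * b)\<^sup>2 \<le> (v * w') * (v' * w)"
    using mult_mono[OF assms(1,2)] assms(3-) by (simp add: power_mult_distrib mult_ac)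
  also have "\<dots> \<le> ((v * w' + v' * w) / 2)\<^sup>2"
    using zero_le_power2[of "v * w' - v' * w"] by (simp add: power2_eq_square field_simps)
  finally have "a * b \<le> (v * w' + v' * w) / 2"
    by (rule power2_le_imp_le) (use assms in simp)
  then have "2 * a * b \<le> v * w' + v' * w" by simp
  then have "a\<^sup>2 + b\<^sup>2 + 2 * a * b \<le> v * w + v' * w' + (v * w' + v' * w)"
    using assms(1,2) by linarith
  then show ?thesis by (simp add: power2_sum algebra_simps)
qed

subsection \<open>Averaging coordinates of a product measure\<close>

text \<open>A pointwise form of measurability with respect to the coordinates in \<open>s\<close>.
  Since it has no exceptional null set, it survives changing a single coordinate.\<close>

definition determined_by :: "('i \<Rightarrow> 'a) measure \<Rightarrow> 'i set \<Rightarrow> (('i \<Rightarrow> 'a) \<Rightarrow> real) \<Rightarrow> bool" where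
  "determined_by N s f \<longleftrightarrow>
     (\<forall>x \<in> space N. \<forall>y \<in> space N. (\<forall>i\<in>s. x i = y i) \<longrightarrow> f x = f y)"

context finite_product_prob_space
begin

text \<open>An explicit version of the conditional expectation given all coordinates other than
  \<open>i\<close>. Where the section in coordinate \<open>i\<close> is not integrable, the Bochner
  integral takes its default value 0.\<close>

definition average :: "'a \<Rightarrow> (('a \<Rightarrow> 'b) \<Rightarrow> real) \<Rightarrow> ('a \<Rightarrow> 'b) \<Rightarrow> real" where
  "average i f x = (\<integral>u. f (x(i := u)) \<partial>M i)"

lemma upd_measurable [measurable]:
  assumes "i \<in> I"
  shows "(\<lambda>(x, u). x(i := u)) \<in> (Pi\<^sub>M I M \<Otimes>\<^sub>M M i) \<rightarrow>\<^sub>M Pi\<^sub>M I M"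
  using measurable_add_dim[of i I M] insert_absorb[OF assms] by simp

lemma upd_in_space:
  assumes "i \<in> I" "x \<in> space (Pi\<^sub>M I M)" "u \<in> space (M i)"
  shows "x(i := u) \<in> space (Pi\<^sub>M I M)"
  using assms by (auto simp: space_PiM PiE_iff extensional_def)

text \<open>Resampling coordinate \<open>i\<close> independently preserves the product law, as boxes
  show. This gives Fubini for a single coordinate without splitting the index set.\<close>

lemma distr_upd:
  assumes i: "i \<in> I"
  shows "distr (Pi\<^sub>M I M \<Otimes>\<^sub>M M i) (Pi\<^sub>M I M) (\<lambda>(x, u). x(i := u)) = Pi\<^sub>M I M"
proof (rule PiM_eqI)
  show "finite I" by (rule finite_index)
  fix A assume A: "\<And>j. j \<in> I \<Longrightarrow> A j \<in> sets (M j)"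
  \<comment> \<open>Coordinate \<open>i\<close> of \<open>x\<close> is overwritten, hence
    unconstrained; the constraint \<open>A i\<close> passes to the new value
    \<open>u\<close>.\<close>
  let ?B = "\<lambda>j. if j = i then space (M i) else A j"
  have "emeasure (distr (Pi\<^sub>M I M \<Otimes>\<^sub>M M i) (Pi\<^sub>M I M) (\<lambda>(x, u). x(i := u))) (Pi\<^sub>E I A)
      = emeasure (Pi\<^sub>M I M \<Otimes>\<^sub>M M i) ((\<lambda>(x, u). x(i := u)) -` Pi\<^sub>E I A \<inter> space (Pi\<^sub>M I M \<Otimes>\<^sub>M M i))"
    using i A by (intro emeasure_distr upd_measurable sets_PiM_I_finite finite_index) auto
  also have "(\<lambda>(x, u). x(i := u)) -` Pi\<^sub>E I A \<inter> space (Pi\<^sub>M I M \<Otimes>\<^sub>M M i) = Pi\<^sub>E I ?B \<times> A i"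
    using i A[THEN sets.sets_into_space]
    by (fastforce simp: space_pair_measure space_PiM PiE_iff extensional_def split: if_split_asm)
  also have "emeasure (Pi\<^sub>M I M \<Otimes>\<^sub>M M i) (Pi\<^sub>E I ?B \<times> A i) = emeasure (Pi\<^sub>M I M) (Pi\<^sub>E I ?B) * emeasure (M i) (A i)"
    using i A by (intro M.emeasure_pair_measure_Times sets_PiM_I_finite finite_index) auto
  also have "emeasure (Pi\<^sub>M I M) (Pi\<^sub>E I ?B) = (\<Prod>j\<in>I. emeasure (M j) (?B j))"
    using A by (intro emeasure_PiM finite_index) auto
  also have "\<dots> * emeasure (M i) (A i) = (\<Prod>j\<in>I. emeasure (M j) (A j))"
    using i by (simp add: prod.remove[OF finite_index i] M.emeasure_space_1 mult.commute)
  finally show "emeasure (distr (Pi\<^sub>M I M \<Otimes>\<^sub>M M i) (Pi\<^sub>M I M) (\<lambda>(x, u). x(i := u))) (Pi\<^sub>E I A)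
      = (\<Prod>j\<in>I. emeasure (M j) (A j))" .
qed simp

lemma borel_measurable_average [measurable]:
  assumes "i \<in> I" and [measurable]: "f \<in> borel_measurable (Pi\<^sub>M I M)"
  shows "average i f \<in> borel_measurable (Pi\<^sub>M I M)"
proof -
  note upd_measurable[OF assms(1), measurable]
  have "(\<lambda>x. f (case x of (x, u) \<Rightarrow> x(i := u))) \<in> borel_measurable (Pi\<^sub>M I M \<Otimes>\<^sub>M M i)" by measurable
  then have "(\<lambda>(x,u). f (x(i := u))) \<in> borel_measurable (Pi\<^sub>M I M \<Otimes>\<^sub>M M i)" by (simp add: case_prod_beta)
  then show ?thesis unfolding average_def [abs_def]
    by (rule M.borel_measurable_lebesgue_integral)
qed

text \<open>By \<open>distr_upd\<close>, \<open>f\<close> and \<open>f (x(i := u))\<close> on the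
  pair space have the same integral; all three claims are then Fubini on that pair space.\<close>

lemma
  assumes i: "i \<in> I" and f: "integrable (Pi\<^sub>M I M) f"
  shows integrable_average: "integrable (Pi\<^sub>M I M) (average i f)"
    and integral_average: "(\<integral>x. average i f x \<partial>Pi\<^sub>M I M) = (\<integral>x. f x \<partial>Pi\<^sub>M I M)"
    and AE_integrable_upd: "AE x in Pi\<^sub>M I M. integrable (M i) (\<lambda>u. f (x(i := u)))"
proof -
  interpret pair_sigma_finite "Pi\<^sub>M I M" "M i" ..
  have m[measurable]: "f \<in> borel_measurable (Pi\<^sub>M I M)" using f by simp
  have "integrable (distr (Pi\<^sub>M I M \<Otimes>\<^sub>M M i) (Pi\<^sub>M I M) (\<lambda>(x, u). x(i := u))) f"
    using f by (simp add: distr_upd[OF i])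
  then have *: "integrable (Pi\<^sub>M I M \<Otimes>\<^sub>M M i) (\<lambda>(x, u). f (x(i := u)))"
    by (subst (asm) integrable_distr_eq) (simp_all add: i case_prod_beta')
  show "integrable (Pi\<^sub>M I M) (average i f)"
    using integrable_fst'[OF *] by (simp add: average_def [abs_def])
  show "AE x in Pi\<^sub>M I M. integrable (M i) (\<lambda>u. f (x(i := u)))"
    using AE_integrable_fst'[OF *] by simp
  have "(\<integral>x. f x \<partial>Pi\<^sub>M I M) = (\<integral>x. f x \<partial>distr (Pi\<^sub>M I M \<Otimes>\<^sub>M M i) (Pi\<^sub>M I M) (\<lambda>(x, u). x(i := u)))"
    by (simp add: distr_upd[OF i])
  also have "\<dots> = (\<integral>z. (\<lambda>(x, u). f (x(i := u))) z \<partial>(Pi\<^sub>M I M \<Otimes>\<^sub>M M i))"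
    by (subst integral_distr) (simp_all add: i case_prod_beta')
  also have "\<dots> = (\<integral>x. average i f x \<partial>Pi\<^sub>M I M)"
    using integral_fst'[OF *] by (simp add: average_def)
  finally show "(\<integral>x. average i f x \<partial>Pi\<^sub>M I M) = (\<integral>x. f x \<partial>Pi\<^sub>M I M)" ..
qed

lemma average_determined_by:
  assumes i: "i \<in> I" and f: "determined_by (Pi\<^sub>M I M) s f"
  shows "determined_by (Pi\<^sub>M I M) (s - {i}) (average i f)"
  unfolding determined_by_def
proof (intro ballI impI)
  fix x y assume x: "x \<in> space (Pi\<^sub>M I M)" and y: "y \<in> space (Pi\<^sub>M I M)"
    and eq: "\<forall>j\<in>s - {i}. x j = y j"
  show "average i f x = average i f y"
    unfolding average_def
  proof (rule Bochner_Integration.integral_cong)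
    fix u assume "u \<in> space (M i)"
    then show "f (x(i := u)) = f (y(i := u))"
      using f upd_in_space[OF i x] upd_in_space[OF i y] eq
      unfolding determined_by_def by auto
  qed simp
qed

text \<open>Along coordinate \<open>i\<close> the function is constant, and \<open>M i\<close> has
  total mass 1. This later makes the \<open>i\<close>-th difference of a function vanish when the
  function ignores coordinate \<open>i\<close>.\<close>

lemma average_absorb:
  assumes i: "i \<in> I" and f: "determined_by (Pi\<^sub>M I M) s f" and "i \<notin> s"
    and x: "x \<in> space (Pi\<^sub>M I M)"
  shows "average i f x = f x"
proof -
  have "average i f x = (\<integral>u. f x \<partial>M i)"
    unfolding average_def
  proof (rule Bochner_Integration.integral_cong)
    fix u assume "u \<in> space (M i)"
    then show "f (x(i := u)) = f x"
      using f upd_in_space[OF i x] x \<open>i \<notin> s\<close>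
      unfolding determined_by_def by (metis fun_upd_apply)
  qed simp
  then show ?thesis by (simp add: M.prob_space)
qed

text \<open>The pull-out property: \<open>average i f\<close> does not change with coordinate
  \<open>i\<close>, so it leaves the inner integral as a constant factor, at every point.\<close>

lemma average_average_mult: "average i (\<lambda>x. average i f x * g x) x = average i f x * average i g x"
  by (simp add: average_def)

text \<open>Conditional Jensen inequality for the square, obtained from Cauchy-Schwarz against the
  constant 1 on almost every section. The average of the square is the integrable majorant.\<close>

lemma integrable_square_average:
  assumes i: "i \<in> I" and f[measurable]: "f \<in> borel_measurable (Pi\<^sub>M I M)"
    and f2: "integrable (Pi\<^sub>M I M) (\<lambda>x. (f x)\<^sup>2)"
  shows "integrable (Pi\<^sub>M I M) (\<lambda>x. (average i f x)\<^sup>2)"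
proof (rule Bochner_Integration.integrable_bound)
  show "integrable (Pi\<^sub>M I M) (average i (\<lambda>x. (f x)\<^sup>2))"
    by (rule integrable_average[OF i f2])
  show "(\<lambda>x. (average i f x)\<^sup>2) \<in> borel_measurable (Pi\<^sub>M I M)" using i by simp
  have upd: "(\<lambda>u. f (x(i := u))) \<in> borel_measurable (M i)" if "x \<in> space (Pi\<^sub>M I M)" for x
  proof (rule measurable_compose[OF _ f])
    have "(\<lambda>u. (x, u)) \<in> M i \<rightarrow>\<^sub>M Pi\<^sub>M I M \<Otimes>\<^sub>M M i" using that by simp
    from measurable_compose[OF this upd_measurable[OF i]]
    show "(\<lambda>u. x(i := u)) \<in> M i \<rightarrow>\<^sub>M Pi\<^sub>M I M" by simp
  qed
  show "AE x in Pi\<^sub>M I M. norm ((average i f x)\<^sup>2) \<le> norm (average i (\<lambda>x. (f x)\<^sup>2) x)"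
    using AE_integrable_upd[OF i f2] AE_space
  proof eventually_elim
    case (elim x)
    have "(\<integral>u. 1 * f (x(i := u)) \<partial>M i)\<^sup>2 \<le> (\<integral>u. 1\<^sup>2 \<partial>M i) * (\<integral>u. (f (x(i := u)))\<^sup>2 \<partial>M i)"
      using elim upd by (intro square_integral_mult_le) auto
    then show ?case by (simp add: average_def M.prob_space)
  qed
qed

text \<open>Averaging is an orthogonal projection: integrate the pull-out property and use that
  averaging preserves integrals.\<close>

lemma integral_average_mult:
  assumes i: "i \<in> I" and [measurable]: "f \<in> borel_measurable (Pi\<^sub>M I M)" "g \<in> borel_measurable (Pi\<^sub>M I M)"
    and f: "integrable (Pi\<^sub>M I M) (\<lambda>x. (f x)\<^sup>2)" and g: "integrable (Pi\<^sub>M I M) (\<lambda>x. (g x)\<^sup>2)"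
  shows "(\<integral>x. average i f x * g x \<partial>Pi\<^sub>M I M) = (\<integral>x. average i f x * average i g x \<partial>Pi\<^sub>M I M)"
proof -
  have "integrable (Pi\<^sub>M I M) (\<lambda>x. average i f x * g x)"
    using i f g by (intro integrable_mult_of_square_integrable integrable_square_average) auto
  from integral_average[OF i this] show ?thesis by (simp add: average_average_mult)
qed

text \<open>The polarised Pythagoras identity: both mixed terms equal the inner product of the
  averages. With \<open>g = f\<close> it splits the squared norm.\<close>

lemma integral_mult_average_decomp:
  assumes i: "i \<in> I" and [measurable]: "f \<in> borel_measurable (Pi\<^sub>M I M)" "g \<in> borel_measurable (Pi\<^sub>M I M)"
    and f: "integrable (Pi\<^sub>M I M) (\<lambda>x. (f x)\<^sup>2)" and g: "integrable (Pi\<^sub>M I M) (\<lambda>x. (g x)\<^sup>2)"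
  shows "(\<integral>x. f x * g x \<partial>Pi\<^sub>M I M) = (\<integral>x. average i f x * average i g x \<partial>Pi\<^sub>M I M)
     + (\<integral>x. (f x - average i f x) * (g x - average i g x) \<partial>Pi\<^sub>M I M)"
proof -
  let ?f = "average i f" and ?g = "average i g"
  have [measurable]: "?f \<in> borel_measurable (Pi\<^sub>M I M)" "?g \<in> borel_measurable (Pi\<^sub>M I M)" using i by auto
  note f' = integrable_square_average[OF i _ f] and g' = integrable_square_average[OF i _ g]
  have int: "integrable (Pi\<^sub>M I M) (\<lambda>x. f x * g x)" "integrable (Pi\<^sub>M I M) (\<lambda>x. ?f x * g x)"
    "integrable (Pi\<^sub>M I M) (\<lambda>x. f x * ?g x)" "integrable (Pi\<^sub>M I M) (\<lambda>x. ?f x * ?g x)"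
    using f g f' g' by (auto intro!: integrable_mult_of_square_integrable)
  have "(\<integral>x. (f x - ?f x) * (g x - ?g x) \<partial>Pi\<^sub>M I M)
      = (\<integral>x. f x * g x - ?f x * g x - f x * ?g x + ?f x * ?g x \<partial>Pi\<^sub>M I M)"
    by (intro Bochner_Integration.integral_cong refl) (simp add: algebra_simps)
  also have "\<dots> = (\<integral>x. f x * g x \<partial>Pi\<^sub>M I M) - (\<integral>x. ?f x * g x \<partial>Pi\<^sub>M I M)
      - (\<integral>x. f x * ?g x \<partial>Pi\<^sub>M I M) + (\<integral>x. ?f x * ?g x \<partial>Pi\<^sub>M I M)"
    using int by simp
  also have "(\<integral>x. ?f x * g x \<partial>Pi\<^sub>M I M) = (\<integral>x. ?f x * ?g x \<partial>Pi\<^sub>M I M)"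
    by (rule integral_average_mult) (use i f g in auto)
  also have "(\<integral>x. f x * ?g x \<partial>Pi\<^sub>M I M) = (\<integral>x. ?f x * ?g x \<partial>Pi\<^sub>M I M)"
    using integral_average_mult[of i g f] i f g by (simp add: mult.commute)
  finally show ?thesis by simp
qed

section \<open>The weighted correlation bound\<close>

text \<open>Induction on \<open>J\<close>. Averaging over a new coordinate \<open>i\<close> removes
  \<open>i\<close> from every \<open>s k\<close>, so the induction must leave \<open>f\<close>,
  \<open>g\<close> and \<open>s\<close> free; the averages fall under the induction hypothesis and
  the differences are estimated directly.\<close>

lemma weighted_correlation_bound:
  fixes q :: "'k \<Rightarrow> real" and p :: real
  assumes K: "finite K" and q: "\<And>k. k \<in> K \<Longrightarrow> 0 \<le> q k" and p: "0 \<le> p" and "J \<subseteq> I"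
    and "\<And>j. j \<in> J \<Longrightarrow> (\<Sum>k\<in>{k \<in> K. j \<in> s k}. q k) \<le> p"
    and "\<And>k. k \<in> K \<Longrightarrow> s k \<subseteq> J"
    and "f \<in> borel_measurable (Pi\<^sub>M I M)" "integrable (Pi\<^sub>M I M) (\<lambda>x. (f x)\<^sup>2)"
    and "(\<integral>x. f x \<partial>Pi\<^sub>M I M) = 0" "determined_by (Pi\<^sub>M I M) J f"
    and "\<And>k. k \<in> K \<Longrightarrow> g k \<in> borel_measurable (Pi\<^sub>M I M)"
    and "\<And>k. k \<in> K \<Longrightarrow> integrable (Pi\<^sub>M I M) (\<lambda>x. (g k x)\<^sup>2)"
    and "\<And>k. k \<in> K \<Longrightarrow> determined_by (Pi\<^sub>M I M) (s k) (g k)"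
  shows "(\<Sum>k\<in>K. q k * (\<integral>x. f x * g k x \<partial>Pi\<^sub>M I M))\<^sup>2
     \<le> (\<integral>x. (f x)\<^sup>2 \<partial>Pi\<^sub>M I M) * (p * (\<Sum>k\<in>K. q k * (\<integral>x. (g k x)\<^sup>2 \<partial>Pi\<^sub>M I M)))"
proof -
  have "finite J" using finite_index \<open>J \<subseteq> I\<close> by (rule rev_finite_subset)
  from this assms(4-) show ?thesis
  proof (induction J arbitrary: f g s)
    case (empty f g s)
    obtain x0 where x0: "x0 \<in> space (Pi\<^sub>M I M)" using P.not_empty by (meson all_not_in_conv)
    \<comment> \<open>With no coordinate left \<open>f\<close> is constant, and being centred it is
      zero, so the left-hand side vanishes.\<close>
    have c: "f x = f x0" if "x \<in> space (Pi\<^sub>M I M)" for x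
      using empty.prems(7) x0 that unfolding determined_by_def by blast
    have "(\<integral>x. f x \<partial>Pi\<^sub>M I M) = (\<integral>x. f x0 \<partial>Pi\<^sub>M I M)"
      by (intro Bochner_Integration.integral_cong refl c)
    then have "f x0 = 0" using empty.prems(6) by (simp add: P.prob_space)
    then have "f x = 0" if "x \<in> space (Pi\<^sub>M I M)" for x using c[OF that] by simp
    then have "(\<integral>x. f x * g k x \<partial>Pi\<^sub>M I M) = (\<integral>x. 0 \<partial>Pi\<^sub>M I M)" for k
      by (intro Bochner_Integration.integral_cong) auto
    then show ?case using p q by (auto intro!: mult_nonneg_nonneg sum_nonneg)
  next
    case (insert i J f g s)
    let ?N = "Pi\<^sub>M I M"
    have i: "i \<in> I" and JI: "J \<subseteq> I" using insert.prems(1) by auto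
    note [measurable] = insert.prems(4,8)
    note f2 = insert.prems(5) and g2 = insert.prems(9)
    have sK: "s k \<subseteq> insert i J" if "k \<in> K" for k using insert.prems(3) that by blast
    have [measurable]: "average i f \<in> borel_measurable ?N" using i by simp
    have [measurable]: "average i (g k) \<in> borel_measurable ?N" if "k \<in> K" for k using i that by simp
    define f' where "f' x = f x - average i f x" for x
    define g' where "g' k x = g k x - average i (g k) x" for k x
    have [measurable]: "f' \<in> borel_measurable ?N" unfolding f'_def[abs_def] by simp
    have [measurable]: "g' k \<in> borel_measurable ?N" if "k \<in> K" for k
      using that unfolding g'_def[abs_def] by simp
    have f'2: "integrable ?N (\<lambda>x. (f' x)\<^sup>2)"
      unfolding f'_def using f2 i by (intro integrable_square_diff integrable_square_average) auto
    have g'2: "integrable ?N (\<lambda>x. (g' k x)\<^sup>2)" if "k \<in> K" for k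
      unfolding g'_def using g2[OF that] i that
      by (intro integrable_square_diff integrable_square_average) auto
    have f_int: "integrable ?N f" by (rule P.square_integrable_imp_integrable[OF _ f2]) simp
    have "(\<Sum>k\<in>K. q k * (\<integral>x. average i f x * average i (g k) x \<partial>?N))\<^sup>2
      \<le> (\<integral>x. (average i f x)\<^sup>2 \<partial>?N) * (p * (\<Sum>k\<in>K. q k * (\<integral>x. (average i (g k) x)\<^sup>2 \<partial>?N)))"
    proof (rule insert.IH[of "\<lambda>k. s k - {i}"])
      show "(\<Sum>k\<in>{k \<in> K. j \<in> s k - {i}}. q k) \<le> p" if "j \<in> J" for j
      proof -
        \<comment> \<open>As \<open>i\<close> lies outside \<open>J\<close>, deleting it from the
          sets does not affect which of them contain \<open>j\<close>, so the weight bound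
          persists.\<close>
        have "{k \<in> K. j \<in> s k - {i}} = {k \<in> K. j \<in> s k}" using that insert.hyps by auto
        then show ?thesis using insert.prems(2)[of j] that by simp
      qed
      show "integrable ?N (\<lambda>x. (average i f x)\<^sup>2)" using i f2 by (intro integrable_square_average) auto
      show "integrable ?N (\<lambda>x. (average i (g k) x)\<^sup>2)" if "k \<in> K" for k
        using i g2 that by (intro integrable_square_average) auto
      show "(\<integral>x. average i f x \<partial>?N) = 0"
        using integral_average[OF i f_int] insert.prems(6) by simp
      show "determined_by ?N J (average i f)"
        using average_determined_by[OF i insert.prems(7)] insert.hyps by simp
      show "determined_by ?N (s k - {i}) (average i (g k))" if "k \<in> K" for k
        using average_determined_by[OF i insert.prems(10)] that .
    qed (use JI sK in auto)
    moreover have "(\<Sum>k\<in>K. q k * (\<integral>x. f' x * g' k x \<partial>?N))\<^sup>2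
      \<le> (\<integral>x. (f' x)\<^sup>2 \<partial>?N) * (p * (\<Sum>k\<in>K. q k * (\<integral>x. (g' k x)\<^sup>2 \<partial>?N)))"
    proof -
      let ?K = "{k \<in> K. i \<in> s k}"
      \<comment> \<open>If \<open>i\<close> is not in \<open>s k\<close>, then \<open>g k\<close>
        equals its own average and the difference \<open>g' k\<close> is zero on the whole
        space.\<close>
      have zero: "(\<integral>x. f' x * g' k x \<partial>?N) = 0" if "k \<in> K - ?K" for k
      proof -
        have "(\<integral>x. f' x * g' k x \<partial>?N) = (\<integral>x. 0 \<partial>?N)"
          using that average_absorb[OF i insert.prems(10)]
          by (intro Bochner_Integration.integral_cong) (auto simp: g'_def)
        then show ?thesis by simp
      qed
      have "(\<Sum>k\<in>K. q k * (\<integral>x. f' x * g' k x \<partial>?N)) = (\<Sum>k\<in>?K. q k * (\<integral>x. f' x * g' k x \<partial>?N))"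
        using zero by (intro sum.mono_neutral_right K) auto
      \<comment> \<open>Splitting each weight into two roots lets the Cauchy-Schwarz inequality for
        sums separate the total weight of the sets containing \<open>i\<close>. That total is at
        most \<open>p\<close>, the only source of the factor \<open>p\<close> in the induction
        step.\<close>
      also have "\<dots> = (\<Sum>k\<in>?K. sqrt (q k) * (sqrt (q k) * (\<integral>x. f' x * g' k x \<partial>?N)))"
        using q by (intro sum.cong) (auto simp flip: mult.assoc)
      also have "(\<dots>)\<^sup>2 \<le> (\<Sum>k\<in>?K. (sqrt (q k))\<^sup>2) * (\<Sum>k\<in>?K. (sqrt (q k) * (\<integral>x. f' x * g' k x \<partial>?N))\<^sup>2)"
        by (rule Cauchy_Schwarz_ineq_sum)
      also have "\<dots> = (\<Sum>k\<in>?K. q k) * (\<Sum>k\<in>?K. q k * (\<integral>x. f' x * g' k x \<partial>?N)\<^sup>2)"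
        using q by (simp add: power_mult_distrib)
      also have "\<dots> \<le> p * (\<Sum>k\<in>?K. q k * ((\<integral>x. (f' x)\<^sup>2 \<partial>?N) * (\<integral>x. (g' k x)\<^sup>2 \<partial>?N)))"
        using q p insert.prems(2)[of i] f'2 g'2
        by (intro mult_mono sum_mono mult_left_mono square_integral_mult_le sum_nonneg mult_nonneg_nonneg) auto
      also have "\<dots> \<le> p * (\<Sum>k\<in>K. q k * ((\<integral>x. (f' x)\<^sup>2 \<partial>?N) * (\<integral>x. (g' k x)\<^sup>2 \<partial>?N)))"
        using q p by (intro mult_left_mono sum_mono2 K mult_nonneg_nonneg) auto
      also have "\<dots> = (\<integral>x. (f' x)\<^sup>2 \<partial>?N) * (p * (\<Sum>k\<in>K. q k * (\<integral>x. (g' k x)\<^sup>2 \<partial>?N)))"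
        by (simp add: sum_distrib_left mult_ac)
      finally show ?thesis .
    qed
    \<comment> \<open>The averaged part and the difference part are merged here; the Pythagoras
      identities that follow turn the sums back into integrals of \<open>f\<close> and
      \<open>g k\<close>.\<close>
    ultimately have "((\<Sum>k\<in>K. q k * (\<integral>x. average i f x * average i (g k) x \<partial>?N))
        + (\<Sum>k\<in>K. q k * (\<integral>x. f' x * g' k x \<partial>?N)))\<^sup>2
      \<le> ((\<integral>x. (average i f x)\<^sup>2 \<partial>?N) + (\<integral>x. (f' x)\<^sup>2 \<partial>?N))
        * (p * (\<Sum>k\<in>K. q k * (\<integral>x. (average i (g k) x)\<^sup>2 \<partial>?N)) + p * (\<Sum>k\<in>K. q k * (\<integral>x. (g' k x)\<^sup>2 \<partial>?N)))"
      using p q by (intro add_square_le) (auto intro!: sum_nonneg mult_nonneg_nonneg)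
    moreover have "(\<integral>x. f x * g k x \<partial>?N) = (\<integral>x. average i f x * average i (g k) x \<partial>?N) + (\<integral>x. f' x * g' k x \<partial>?N)"
      if "k \<in> K" for k
      using integral_mult_average_decomp[OF i _ _ f2 g2[OF that]] that by (simp add: f'_def g'_def)
    moreover have "(\<integral>x. (f x)\<^sup>2 \<partial>?N) = (\<integral>x. (average i f x)\<^sup>2 \<partial>?N) + (\<integral>x. (f' x)\<^sup>2 \<partial>?N)"
      using integral_mult_average_decomp[OF i _ _ f2 f2] by (simp add: f'_def power2_eq_square)
    moreover have "(\<integral>x. (g k x)\<^sup>2 \<partial>?N) = (\<integral>x. (average i (g k) x)\<^sup>2 \<partial>?N) + (\<integral>x. (g' k x)\<^sup>2 \<partial>?N)"
      if "k \<in> K" for k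
      using integral_mult_average_decomp[OF i _ _ g2[OF that] g2[OF that]] that by (simp add: g'_def power2_eq_square)
    ultimately show ?case by (simp add: distrib_left sum.distrib)
  qed
qed

end

subsection \<open>The adjoined point\<close>

lemma adjoin_point_generator:
  "insert {None} ((`) Some ` sets F) \<subseteq> Pow (insert None (Some ` space F))"
  by (auto dest: sets.sets_into_space[THEN subsetD])

lemma space_adjoin_point [simp]: "space (adjoin_point F) = insert None (Some ` space F)"
  unfolding adjoin_point_def by (rule space_measure_of[OF adjoin_point_generator])

lemma sets_adjoin_point:
  "sets (adjoin_point F) =
     sigma_sets (insert None (Some ` space F)) (insert {None} ((`) Some ` sets F))"
  unfolding adjoin_point_def by (rule sets_measure_of[OF adjoin_point_generator])

lemma measurable_Some [measurable]: "Some \<in> F \<rightarrow>\<^sub>M adjoin_point F"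
  unfolding adjoin_point_def
proof (rule measurable_measure_of[OF adjoin_point_generator])
  fix A assume "A \<in> insert {None} ((`) Some ` sets F)"
  then consider "A = {None}" | B where "B \<in> sets F" "A = Some ` B" by blast
  then show "Some -` A \<inter> space F \<in> sets F"
  proof cases
    case 2
    then have "Some -` A \<inter> space F = B" using sets.sets_into_space[OF 2(1)] by auto
    then show ?thesis using 2 by simp
  next
    case 1
    then have "Some -` A \<inter> space F = {}" by auto
    then show ?thesis by simp
  qed
qed simp

text \<open>Extends a measurable function by a chosen value at the extra point; preimages split into
  a part of \<open>{None}\<close> and an embedded preimage in \<open>F\<close>.\<close>

lemma measurable_case_adjoin_point:
  assumes f[measurable]: "f \<in> F \<rightarrow>\<^sub>M N" and c: "c \<in> space N"
  shows "case_option c f \<in> adjoin_point F \<rightarrow>\<^sub>M N"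
proof (rule measurableI)
  show "case_option c f y \<in> space N" if "y \<in> space (adjoin_point F)" for y
    using that c measurable_space[OF f] by auto
  fix A assume A: "A \<in> sets N"
  let ?S = "Some ` (f -` A \<inter> space F)"
  have eq: "case_option c f -` A \<inter> space (adjoin_point F) = (if c \<in> A then {None} else {}) \<union> ?S"
    by auto
  have "?S \<in> sets (adjoin_point F)" "{None} \<in> sets (adjoin_point F)"
    unfolding sets_adjoin_point using measurable_sets[OF f A] by (auto intro: sigma_sets.Basic)
  then show "case_option c f -` A \<inter> space (adjoin_point F) \<in> sets (adjoin_point F)"
    unfolding eq by (intro sets.Un) simp_all
qed

subsection \<open>Degeneracy and independence\<close>

context prob_space
begin

lemma variance_zero_imp_AE_const:
  fixes U :: "'a \<Rightarrow> real"
  assumes [measurable]: "U \<in> borel_measurable M" and U: "integrable M (\<lambda>\<omega>. (U \<omega>)\<^sup>2)"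
    and "variance U = 0"
  shows "AE \<omega> in M. U \<omega> = expectation U"
proof -
  have "integrable M (\<lambda>\<omega>. (U \<omega> - expectation U)\<^sup>2)"
    by (rule integrable_square_diff) (use U in auto)
  from integral_nonneg_eq_0_iff_AE[OF this] show ?thesis using assms(3) by simp
qed

lemma AE_const_imp_variance_zero:
  fixes U :: "'a \<Rightarrow> real"
  assumes [measurable]: "U \<in> borel_measurable M" and "AE \<omega> in M. U \<omega> = c"
  shows "variance U = 0"
proof -
  have "expectation U = (\<integral>\<omega>. c \<partial>M)" by (rule integral_cong_AE) (use assms in auto)
  then have "expectation U = c" by (simp add: prob_space)
  then have "variance U = (\<integral>\<omega>. 0 \<partial>M)" by (intro integral_cong_AE) (use assms in auto)
  then show ?thesis by simp
qed

lemma not_degenerate_if_test_function: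
  assumes [measurable]: "random_variable S X" and "\<phi> \<in> correlation_test_functions S X"
  shows "\<not> degenerate S X"
proof
  assume "degenerate S X"
  with assms obtain c where "AE \<omega> in M. \<phi> (X \<omega>) = c"
    unfolding degenerate_def correlation_test_functions_def by blast
  moreover have [measurable]: "\<phi> \<in> borel_measurable S"
    using assms by (simp add: correlation_test_functions_def)
  ultimately have "variance (\<lambda>\<omega>. \<phi> (X \<omega>)) = 0" by (intro AE_const_imp_variance_zero) auto
  with assms show False by (simp add: correlation_test_functions_def)
qed

text \<open>A non-constant function of \<open>X\<close> may fail to be square-integrable. Composing
  it with \<open>arctan\<close> makes it bounded and, by injectivity, keeps it non-constant;
  subtracting the mean centres it.\<close>

lemma not_degenerate_bounded_function:
  assumes [measurable]: "random_variable S X" and "\<not> degenerate S X"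
  shows "\<exists>f \<in> borel_measurable S. \<exists>B::real. (\<forall>x. \<bar>f x\<bar> \<le> B) \<and>
    expectation (\<lambda>\<omega>. f (X \<omega>)) = 0 \<and> expectation (\<lambda>\<omega>. (f (X \<omega>))\<^sup>2) > 0"
proof -
  obtain h where h[measurable]: "h \<in> borel_measurable S" and nc: "\<And>c::real. \<not> (AE \<omega> in M. h (X \<omega>) = c)"
    using assms(2) unfolding degenerate_def by blast
  define U where "U \<omega> = arctan (h (X \<omega>))" for \<omega>
  define f where "f x = arctan (h x) - expectation U" for x
  have [measurable]: "U \<in> borel_measurable M" unfolding U_def[abs_def] by simp
  have at: "\<bar>arctan r\<bar> \<le> 2" for r using arctan_bounded[of r] pi_less_4 by linarith
  have U2: "integrable M (\<lambda>\<omega>. (U \<omega>)\<^sup>2)"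
  proof (rule integrable_const_bound)
    have "(U \<omega>)\<^sup>2 \<le> 2\<^sup>2" for \<omega> unfolding U_def by (rule power2_le_iff_abs_le[THEN iffD2]) (simp_all add: at)
    then show "AE \<omega> in M. norm ((U \<omega>)\<^sup>2) \<le> 2\<^sup>2" by simp
  qed simp
  have "variance U \<noteq> 0"
  proof
    assume "variance U = 0"
    with U2 have "AE \<omega> in M. U \<omega> = expectation U" by (intro variance_zero_imp_AE_const) auto
    \<comment> \<open>Applying \<open>tan\<close> undoes \<open>arctan\<close>, so an almost surely
      constant \<open>U\<close> would make \<open>h (X \<omega>)\<close> almost surely
      constant.\<close>
    then have "AE \<omega> in M. h (X \<omega>) = tan (expectation U)"
      by eventually_elim (metis U_def tan_arctan)
    with nc show False by blast
  qed
  then have var: "variance U > 0" using variance_positive[of U] by linarith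
  have "integrable M U" by (rule square_integrable_imp_integrable[OF _ U2]) simp
  then have "expectation (\<lambda>\<omega>. f (X \<omega>)) = 0" by (simp add: f_def prob_space flip: U_def)
  moreover have "expectation (\<lambda>\<omega>. (f (X \<omega>))\<^sup>2) > 0" using var by (simp add: f_def flip: U_def)
  moreover have "\<bar>f x\<bar> \<le> 2 + \<bar>expectation U\<bar>" for x using at[of "h x"] unfolding f_def by linarith
  moreover have "f \<in> borel_measurable S" unfolding f_def[abs_def] by simp
  ultimately show ?thesis by blast
qed

section \<open>Restriction to an event of an independent element\<close>

text \<open>Independence as an equality of measures: restricting to an event of \<open>T\<close>
  only rescales the law of \<open>X\<close>. Integrals of arbitrary \<open>h\<close> then follow by
  change of variables.\<close>

lemma distr_density_indep_elements:
  assumes ind: "indep_elements S' T S X" and A: "A \<in> sets S'"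
  shows "distr (density M (indicator (T -` A \<inter> space M))) S X
       = density (distr M S X) (\<lambda>_. ennreal (prob (T -` A \<inter> space M)))"
proof (rule measure_eqI)
  have [measurable]: "random_variable S X" "random_variable S' T"
    using ind by (auto simp: indep_elements_def)
  let ?A = "T -` A \<inter> space M"
  have A': "?A \<in> events" using A by measurable
  fix B assume "B \<in> sets (distr (density M (indicator ?A)) S X)"
  then have B: "B \<in> sets S" by simp
  let ?B = "X -` B \<inter> space M"
  have B': "?B \<in> events" using B by measurable
  have "emeasure (distr (density M (indicator ?A)) S X) B = emeasure (density M (indicator ?A)) ?B"
    using B by (subst emeasure_distr) auto
  also have "\<dots> = (\<integral>\<^sup>+\<omega>. indicator ?A \<omega> * indicator ?B \<omega> \<partial>M)"
    using A' B' by (intro emeasure_density borel_measurable_indicator)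
  also have "\<dots> = (\<integral>\<^sup>+\<omega>. indicator (?A \<inter> ?B) \<omega> \<partial>M)"
    by (simp only: indicator_inter_arith)
  also have "\<dots> = ennreal (prob (?A \<inter> ?B))"
    using A' B' by (subst nn_integral_indicator) (auto simp: emeasure_eq_measure)
  also have "prob (?A \<inter> ?B) = prob ?A * prob ?B"
    using ind A B unfolding indep_elements_def by (intro indep_setD) auto
  also have "ennreal \<dots> = emeasure (density (distr M S X) (\<lambda>_. ennreal (prob ?A))) B"
    using B by (simp add: emeasure_density_const emeasure_distr emeasure_eq_measure ennreal_mult)
  finally show "emeasure (distr (density M (indicator ?A)) S X) B
    = emeasure (density (distr M S X) (\<lambda>_. ennreal (prob ?A))) B" .
qed simp

text \<open>The probability stays inside the integrability claim, because on a null event nothing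
  can be inferred about \<open>h\<close> itself.\<close>

lemma
  fixes h :: "'b \<Rightarrow> real"
  assumes ind: "indep_elements S' T S X" and A: "A \<in> sets S'" and [measurable]: "h \<in> borel_measurable S"
  shows integrable_indicator_indep_elements:
      "integrable M (\<lambda>\<omega>. indicator (T -` A \<inter> space M) \<omega> * h (X \<omega>))
       \<longleftrightarrow> integrable (distr M S X) (\<lambda>x. prob (T -` A \<inter> space M) * h x)"
    and integral_indicator_indep_elements:
      "(\<integral>\<omega>. indicator (T -` A \<inter> space M) \<omega> * h (X \<omega>) \<partial>M)
       = prob (T -` A \<inter> space M) * (\<integral>x. h x \<partial>distr M S X)"
proof -
  have [measurable]: "random_variable S X" "random_variable S' T"
    using ind by (auto simp: indep_elements_def)
  let ?A = "T -` A \<inter> space M" and ?D = "distr M S X"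
  have [measurable]: "?A \<in> events" using A by measurable
  \<comment> \<open>Densities take values in \<open>ennreal\<close>; the rules for real integrands
    expect such a density as the image of a real function.\<close>
  have ind_eq: "indicator ?A = (\<lambda>\<omega>. ennreal (indicator ?A \<omega>))" by (auto simp: ennreal_indicator)
  have X': "X \<in> density M (\<lambda>\<omega>. ennreal (indicator ?A \<omega>)) \<rightarrow>\<^sub>M S" by simp
  have eq: "distr (density M (\<lambda>\<omega>. ennreal (indicator ?A \<omega>))) S X = density ?D (\<lambda>_. ennreal (prob ?A))"
    using distr_density_indep_elements[OF ind A] unfolding ind_eq .
  have "integrable M (\<lambda>\<omega>. indicator ?A \<omega> * h (X \<omega>))
      \<longleftrightarrow> integrable (density M (\<lambda>\<omega>. ennreal (indicator ?A \<omega>))) (\<lambda>\<omega>. h (X \<omega>))"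
    by (subst integrable_real_density) auto
  also have "\<dots> \<longleftrightarrow> integrable (density ?D (\<lambda>_. ennreal (prob ?A))) h"
    unfolding eq[symmetric] by (subst integrable_distr_eq) auto
  also have "\<dots> \<longleftrightarrow> integrable ?D (\<lambda>x. prob ?A * h x)"
    by (subst integrable_real_density) auto
  finally show "integrable M (\<lambda>\<omega>. indicator ?A \<omega> * h (X \<omega>)) \<longleftrightarrow> integrable ?D (\<lambda>x. prob ?A * h x)" .
  have "(\<integral>\<omega>. indicator ?A \<omega> * h (X \<omega>) \<partial>M)
      = (\<integral>\<omega>. h (X \<omega>) \<partial>density M (\<lambda>\<omega>. ennreal (indicator ?A \<omega>)))"
    by (subst integral_real_density) auto
  also have "\<dots> = (\<integral>x. h x \<partial>density ?D (\<lambda>_. ennreal (prob ?A)))"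
    unfolding eq[symmetric] by (subst integral_distr) auto
  also have "\<dots> = prob ?A * (\<integral>x. h x \<partial>?D)"
    by (subst integral_real_density) auto
  finally show "(\<integral>\<omega>. indicator ?A \<omega> * h (X \<omega>) \<partial>M) = prob ?A * (\<integral>x. h x \<partial>?D)" .
qed

end

subsection \<open>The masked vector\<close>

locale masked_vector = prob_space M for M :: "'w measure" +
  fixes I :: "'i set" and F :: "'b measure" and X :: "'i \<Rightarrow> 'w \<Rightarrow> 'b"
    and T :: "'w \<Rightarrow> 'i set" and Y :: "'i \<Rightarrow> 'w \<Rightarrow> 'b option"
  assumes finite_I: "finite I" and I_ne: "I \<noteq> {}"
    and indep_X: "indep_vars (\<lambda>_. F) X I"
    and indep_T: "indep_elements (count_space (Pow I)) T (\<Pi>\<^sub>M i\<in>I. F) (\<lambda>\<omega>. \<lambda>i\<in>I. X i \<omega>)"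
    and Y_eq: "\<And>i \<omega>. i \<in> I \<Longrightarrow> \<omega> \<in> space M \<Longrightarrow> Y i \<omega> = (if i \<in> T \<omega> then Some (X i \<omega>) else None)"
begin

text \<open>Outside \<open>I\<close> the marginal is padded with an arbitrary one, because the locale
  \<open>finite_product_prob_space\<close> asks for a probability measure at every index.\<close>

definition marginal :: "'i \<Rightarrow> 'b measure" where
  "marginal i = distr M F (X (if i \<in> I then i else SOME j. j \<in> I))"

abbreviation law :: "('i \<Rightarrow> 'b) measure" where
  "law \<equiv> Pi\<^sub>M I marginal"

abbreviation XX :: "'w \<Rightarrow> 'i \<Rightarrow> 'b" where
  "XX \<omega> \<equiv> (\<lambda>i\<in>I. X i \<omega>)"

abbreviation YY :: "'w \<Rightarrow> 'i \<Rightarrow> 'b option" where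
  "YY \<omega> \<equiv> (\<lambda>i\<in>I. Y i \<omega>)"

text \<open>Masking by a fixed set: on the event \<open>T = t\<close> the vector \<open>YY\<close>
  is the fixed measurable function \<open>mask t\<close> of \<open>XX\<close>.\<close>

definition mask :: "'i set \<Rightarrow> ('i \<Rightarrow> 'b) \<Rightarrow> 'i \<Rightarrow> 'b option" where
  "mask t x = (\<lambda>i\<in>I. if i \<in> t then Some (x i) else None)"

definition weight :: "'i set \<Rightarrow> real" where
  "weight t = prob {\<omega> \<in> space M. T \<omega> = t}"

lemma X_measurable [measurable]: "i \<in> I \<Longrightarrow> X i \<in> M \<rightarrow>\<^sub>M F"
  using indep_X by (simp add: indep_vars_def)

lemma XX_measurable [measurable]: "XX \<in> M \<rightarrow>\<^sub>M (\<Pi>\<^sub>M i\<in>I. F)"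
  by (rule measurable_restrict) simp

lemma T_measurable [measurable]: "T \<in> M \<rightarrow>\<^sub>M count_space (Pow I)"
  using indep_T by (simp add: indep_elements_def)

lemma T_subset: "\<omega> \<in> space M \<Longrightarrow> T \<omega> \<subseteq> I"
  using measurable_space[OF T_measurable] by simp

text \<open>The random set has finitely many possible values in a discrete space, so any predicate
  of it defines an event.\<close>

lemma T_events [measurable]: "{\<omega> \<in> space M. P (T \<omega>)} \<in> events"
proof -
  have "T -` {t \<in> Pow I. P t} \<inter> space M \<in> events" by (rule measurable_sets[OF T_measurable]) auto
  moreover have "T -` {t \<in> Pow I. P t} \<inter> space M = {\<omega> \<in> space M. P (T \<omega>)}" using T_subset by auto
  ultimately show ?thesis by simp
qed

lemma sets_law [measurable_cong]: "sets law = sets (\<Pi>\<^sub>M i\<in>I. F)"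
  by (rule sets_PiM_cong) (auto simp: marginal_def)

lemma space_law: "space law = (\<Pi>\<^sub>E i\<in>I. space F)"
  by (simp add: space_PiM marginal_def)

lemma distr_XX: "distr M (\<Pi>\<^sub>M i\<in>I. F) XX = law"
proof -
  have "distr M (\<Pi>\<^sub>M i\<in>I. F) XX = (\<Pi>\<^sub>M i\<in>I. distr M F (X i))"
    using indep_X by (subst (asm) indep_vars_iff_distr_eq_PiM'[OF I_ne]) auto
  also have "\<dots> = law" by (rule PiM_cong) (auto simp: marginal_def)
  finally show ?thesis .
qed

sublocale L: finite_product_prob_space marginal I
proof -
  have "prob_space (marginal i)" for i
    unfolding marginal_def using I_ne some_in_eq[of I] by (intro prob_space_distr) auto
  then interpret product_prob_space marginal I by (rule product_prob_spaceI)
  show "finite_product_prob_space marginal I" by unfold_locales (rule finite_I)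
qed

lemma mask_measurable [measurable]: "mask t \<in> (\<Pi>\<^sub>M i\<in>I. F) \<rightarrow>\<^sub>M (\<Pi>\<^sub>M i\<in>I. adjoin_point F)"
  unfolding mask_def[abs_def]
proof (rule measurable_restrict)
  fix i assume "i \<in> I"
  then show "(\<lambda>x. if i \<in> t then Some (x i) else None) \<in> (\<Pi>\<^sub>M i\<in>I. F) \<rightarrow>\<^sub>M adjoin_point F"
    by (cases "i \<in> t") (auto intro!: measurable_compose[OF _ measurable_Some] measurable_component_singleton)
qed

lemma YY_eq: "\<omega> \<in> space M \<Longrightarrow> YY \<omega> = mask (T \<omega>) (XX \<omega>)"
  by (auto simp: mask_def Y_eq fun_eq_iff)

lemma YY_measurable [measurable]: "YY \<in> M \<rightarrow>\<^sub>M (\<Pi>\<^sub>M i\<in>I. adjoin_point F)"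
proof (rule measurable_restrict)
  fix i assume i: "i \<in> I"
  have "(\<lambda>\<omega>. if i \<in> T \<omega> then Some (X i \<omega>) else None) \<in> M \<rightarrow>\<^sub>M adjoin_point F"
    using i by (intro measurable_If measurable_compose[OF _ measurable_Some] T_events) auto
  then show "Y i \<in> M \<rightarrow>\<^sub>M adjoin_point F"
    by (subst measurable_cong[OF Y_eq[OF i]])
qed

section \<open>Conditioning on the random set\<close>

text \<open>The law of total expectation over the finitely many values of \<open>T\<close>;
  independence replaces the conditional law of \<open>XX\<close> by \<open>law\<close>. The weight
  remains in \<open>integrable_slice\<close> because a slice of weight zero carries no information
  about \<open>H t\<close>.\<close>

lemma
  fixes H :: "'i set \<Rightarrow> ('i \<Rightarrow> 'b) \<Rightarrow> real"
  assumes H[measurable]: "\<And>t. t \<subseteq> I \<Longrightarrow> H t \<in> borel_measurable (\<Pi>\<^sub>M i\<in>I. F)"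
    and int: "integrable M (\<lambda>\<omega>. H (T \<omega>) (XX \<omega>))"
  shows integrable_slice: "t \<subseteq> I \<Longrightarrow> integrable law (\<lambda>x. weight t * H t x)"
    and integral_slices: "expectation (\<lambda>\<omega>. H (T \<omega>) (XX \<omega>)) = (\<Sum>t\<in>Pow I. weight t * (\<integral>x. H t x \<partial>law))"
proof -
  have vimage: "T -` {t} \<inter> space M = {\<omega> \<in> space M. T \<omega> = t}" for t by auto
  have slice: "integrable M (\<lambda>\<omega>. indicator {\<omega> \<in> space M. T \<omega> = t} \<omega> * H t (XX \<omega>))" for t
  proof -
    have "integrable M (\<lambda>\<omega>. H (T \<omega>) (XX \<omega>) * indicator {\<omega> \<in> space M. T \<omega> = t} \<omega>)"
      by (rule integrable_real_mult_indicator[OF _ int]) simp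
    also have "(\<lambda>\<omega>. H (T \<omega>) (XX \<omega>) * indicator {\<omega> \<in> space M. T \<omega> = t} \<omega>)
      = (\<lambda>\<omega>. indicator {\<omega> \<in> space M. T \<omega> = t} \<omega> * H t (XX \<omega>))"
      by (auto simp: indicator_def fun_eq_iff)
    finally show ?thesis .
  qed
  show "integrable law (\<lambda>x. weight t * H t x)" if "t \<subseteq> I" for t
    using slice[of t] integrable_indicator_indep_elements[OF indep_T, of "{t}" "H t"] that
    by (simp add: vimage distr_XX weight_def)
  have "expectation (\<lambda>\<omega>. H (T \<omega>) (XX \<omega>))
    = expectation (\<lambda>\<omega>. \<Sum>t\<in>Pow I. indicator {\<omega> \<in> space M. T \<omega> = t} \<omega> * H t (XX \<omega>))"
  proof (rule Bochner_Integration.integral_cong)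
    fix \<omega> assume \<omega>: "\<omega> \<in> space M"
    have "(\<Sum>t\<in>Pow I. indicator {\<omega> \<in> space M. T \<omega> = t} \<omega> * H t (XX \<omega>))
      = (\<Sum>t\<in>Pow I. if t = T \<omega> then H t (XX \<omega>) else 0)"
      using \<omega> by (intro sum.cong) auto
    also have "\<dots> = H (T \<omega>) (XX \<omega>)"
      using finite_I T_subset[OF \<omega>] by simp
    finally show "H (T \<omega>) (XX \<omega>) = (\<Sum>t\<in>Pow I. indicator {\<omega> \<in> space M. T \<omega> = t} \<omega> * H t (XX \<omega>))" ..
  qed simp
  also have "\<dots> = (\<Sum>t\<in>Pow I. expectation (\<lambda>\<omega>. indicator {\<omega> \<in> space M. T \<omega> = t} \<omega> * H t (XX \<omega>)))"
    by (rule Bochner_Integration.integral_sum) (rule slice)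
  also have "\<dots> = (\<Sum>t\<in>Pow I. weight t * (\<integral>x. H t x \<partial>law))"
  proof (rule sum.cong)
    fix t assume "t \<in> Pow I"
    then show "expectation (\<lambda>\<omega>. indicator {\<omega> \<in> space M. T \<omega> = t} \<omega> * H t (XX \<omega>)) = weight t * (\<integral>x. H t x \<partial>law)"
      using integral_indicator_indep_elements[OF indep_T, of "{t}" "H t"]
      by (simp add: vimage distr_XX weight_def)
  qed simp
  finally show "expectation (\<lambda>\<omega>. H (T \<omega>) (XX \<omega>)) = (\<Sum>t\<in>Pow I. weight t * (\<integral>x. H t x \<partial>law))" .
qed

lemma sum_weight: "(\<Sum>t\<in>{t \<in> Pow I. P t}. weight t) = prob {\<omega> \<in> space M. P (T \<omega>)}"
proof -
  have "{\<omega> \<in> space M. P (T \<omega>)} = (\<Union>t\<in>{t \<in> Pow I. P t}. {\<omega> \<in> space M. T \<omega> = t})"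
    using T_subset by auto
  also have "prob \<dots> = (\<Sum>t\<in>{t \<in> Pow I. P t}. prob {\<omega> \<in> space M. T \<omega> = t})"
    using finite_I by (intro finite_measure_finite_Union) (auto simp: disjoint_family_on_def)
  finally show ?thesis by (simp add: weight_def)
qed

section \<open>The upper bound\<close>

text \<open>After centring, covariance and variance of the masked side become weighted sums over the
  values of \<open>T\<close>. They have the shape of \<open>weighted_correlation_bound\<close>, with
  the sets \<open>t\<close> themselves as index family.\<close>

lemma covariance_square_le:
  assumes \<phi>: "\<phi> \<in> correlation_test_functions (\<Pi>\<^sub>M i\<in>I. F) XX"
    and \<psi>: "\<psi> \<in> correlation_test_functions (\<Pi>\<^sub>M i\<in>I. adjoin_point F) YY"
    and p: "0 \<le> p" "\<And>i. i \<in> I \<Longrightarrow> prob {\<omega> \<in> space M. i \<in> T \<omega>} \<le> p"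
  shows "(covariance (\<lambda>\<omega>. \<phi> (XX \<omega>)) (\<lambda>\<omega>. \<psi> (YY \<omega>)))\<^sup>2
    \<le> variance (\<lambda>\<omega>. \<phi> (XX \<omega>)) * (p * variance (\<lambda>\<omega>. \<psi> (YY \<omega>)))"
proof -
  have [measurable]: "\<phi> \<in> borel_measurable (\<Pi>\<^sub>M i\<in>I. F)"
      "\<psi> \<in> borel_measurable (\<Pi>\<^sub>M i\<in>I. adjoin_point F)"
    and sq: "integrable M (\<lambda>\<omega>. (\<phi> (XX \<omega>))\<^sup>2)" "integrable M (\<lambda>\<omega>. (\<psi> (YY \<omega>))\<^sup>2)"
    using \<phi> \<psi> by (auto simp: correlation_test_functions_def)
  define a where "a = expectation (\<lambda>\<omega>. \<phi> (XX \<omega>))"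
  define b where "b = expectation (\<lambda>\<omega>. \<psi> (YY \<omega>))"
  define f where "f x = \<phi> x - a" for x
  define g where "g t x = \<psi> (mask t x) - b" for t x
  have [measurable]: "f \<in> borel_measurable (\<Pi>\<^sub>M i\<in>I. F)" unfolding f_def[abs_def] by simp
  have [measurable]: "g t \<in> borel_measurable (\<Pi>\<^sub>M i\<in>I. F)" for t unfolding g_def[abs_def] by simp
  have gT: "g (T \<omega>) (XX \<omega>) = \<psi> (YY \<omega>) - b" if "\<omega> \<in> space M" for \<omega>
    using that by (simp only: g_def YY_eq)
  have [measurable]: "(\<lambda>\<omega>. g (T \<omega>) (XX \<omega>)) \<in> borel_measurable M"
    by (subst measurable_cong[OF gT]) auto
  have f2: "integrable M (\<lambda>\<omega>. (f (XX \<omega>))\<^sup>2)"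
    unfolding f_def by (rule integrable_square_diff) (use sq in auto)
  have "integrable M (\<lambda>\<omega>. (\<psi> (YY \<omega>) - b)\<^sup>2)"
    by (rule integrable_square_diff) (use sq in auto)
  then have g2: "integrable M (\<lambda>\<omega>. (g (T \<omega>) (XX \<omega>))\<^sup>2)"
    by (subst Bochner_Integration.integrable_cong[OF refl]) (use gT in auto)
  have fg: "integrable M (\<lambda>\<omega>. f (XX \<omega>) * g (T \<omega>) (XX \<omega>))"
    by (rule integrable_mult_of_square_integrable) (use f2 g2 in auto)
  \<comment> \<open>Square-integrability of \<open>g t\<close> can be recovered from the slice only
    after dividing by its weight, so sets of weight zero are dropped; they contribute nothing to the
    sums.\<close>
  let ?K = "{t \<in> Pow I. weight t > 0}"
  have weight_nonneg: "0 \<le> weight t" for t by (simp add: weight_def)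
  have restrict_K: "(\<Sum>t\<in>Pow I. weight t * c t) = (\<Sum>t\<in>?K. weight t * c t)" for c :: "'i set \<Rightarrow> real"
    using finite_I weight_nonneg by (intro sum.mono_neutral_right) (auto simp: less_le)
  have cov: "covariance (\<lambda>\<omega>. \<phi> (XX \<omega>)) (\<lambda>\<omega>. \<psi> (YY \<omega>)) = (\<Sum>t\<in>?K. weight t * (\<integral>x. f x * g t x \<partial>law))"
  proof -
    have "covariance (\<lambda>\<omega>. \<phi> (XX \<omega>)) (\<lambda>\<omega>. \<psi> (YY \<omega>)) = expectation (\<lambda>\<omega>. f (XX \<omega>) * g (T \<omega>) (XX \<omega>))"
      unfolding covariance_def a_def[symmetric] b_def[symmetric]
      by (intro Bochner_Integration.integral_cong) (auto simp: gT f_def)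
    also have "\<dots> = (\<Sum>t\<in>Pow I. weight t * (\<integral>x. f x * g t x \<partial>law))"
      by (rule integral_slices[of "\<lambda>t x. f x * g t x"]) (use fg in auto)
    finally show ?thesis unfolding restrict_K .
  qed
  have var_\<psi>: "variance (\<lambda>\<omega>. \<psi> (YY \<omega>)) = (\<Sum>t\<in>?K. weight t * (\<integral>x. (g t x)\<^sup>2 \<partial>law))"
  proof -
    have "variance (\<lambda>\<omega>. \<psi> (YY \<omega>)) = expectation (\<lambda>\<omega>. (g (T \<omega>) (XX \<omega>))\<^sup>2)"
      unfolding b_def[symmetric] by (intro Bochner_Integration.integral_cong) (auto simp: gT)
    also have "\<dots> = (\<Sum>t\<in>Pow I. weight t * (\<integral>x. (g t x)\<^sup>2 \<partial>law))"
      by (rule integral_slices[of "\<lambda>t x. (g t x)\<^sup>2"]) (use g2 in auto)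
    finally show ?thesis unfolding restrict_K .
  qed
  have var_\<phi>: "variance (\<lambda>\<omega>. \<phi> (XX \<omega>)) = (\<integral>x. (f x)\<^sup>2 \<partial>law)"
    unfolding a_def[symmetric] f_def distr_XX[symmetric] by (subst integral_distr) auto
  show ?thesis
    unfolding cov var_\<phi> var_\<psi>
  proof (rule L.weighted_correlation_bound[where J = I and s = "\<lambda>t. t"])
    show "finite ?K" using finite_I by simp
    show "(\<Sum>t\<in>{t \<in> ?K. j \<in> t}. weight t) \<le> p" if "j \<in> I" for j
    proof -
      \<comment> \<open>Over all sets containing \<open>j\<close> the weights add up to the
        probability that \<open>j\<close> lies in \<open>T\<close>.\<close>
      have "(\<Sum>t\<in>{t \<in> ?K. j \<in> t}. weight t) \<le> (\<Sum>t\<in>{t \<in> Pow I. j \<in> t}. weight t)"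
        using finite_I weight_nonneg by (intro sum_mono2) auto
      also have "\<dots> \<le> p" unfolding sum_weight by (rule p(2)[OF that])
      finally show ?thesis .
    qed
    show "integrable law (\<lambda>x. (f x)\<^sup>2)"
      using f2 unfolding distr_XX[symmetric] by (subst integrable_distr_eq) auto
    have "integrable M (\<lambda>\<omega>. \<phi> (XX \<omega>))"
      by (rule square_integrable_imp_integrable) (use sq in auto)
    then have "expectation (\<lambda>\<omega>. f (XX \<omega>)) = 0" by (simp add: f_def prob_space a_def)
    then show "(\<integral>x. f x \<partial>law) = 0"
      unfolding distr_XX[symmetric] by (subst integral_distr) auto
    show "integrable law (\<lambda>x. (g t x)\<^sup>2)" if "t \<in> ?K" for t
      using integrable_slice[of "\<lambda>t x. (g t x)\<^sup>2" t, OF _ g2] that by simp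
    show "determined_by law I f"
      unfolding determined_by_def
    proof (intro ballI impI)
      fix x y assume "x \<in> space law" "y \<in> space law" "\<forall>i\<in>I. x i = y i"
      \<comment> \<open>Points of the product space are extensional, so agreement on
        \<open>I\<close> is equality.\<close>
      then have "x = y" unfolding space_law by (metis PiE_ext)
      then show "f x = f y" by simp
    qed
    show "determined_by law t (g t)" for t
      unfolding determined_by_def
    proof (intro ballI impI)
      fix x y :: "'i \<Rightarrow> 'b" assume "\<forall>i\<in>t. x i = y i"
      then have "mask t x = mask t y" by (auto simp: mask_def fun_eq_iff)
      then show "g t x = g t y" by (simp add: g_def)
    qed
  qed (use p weight_nonneg in auto)
qed

lemma pearson_correlation_le:
  assumes \<phi>: "\<phi> \<in> correlation_test_functions (\<Pi>\<^sub>M i\<in>I. F) XX"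
    and \<psi>: "\<psi> \<in> correlation_test_functions (\<Pi>\<^sub>M i\<in>I. adjoin_point F) YY"
    and p: "0 \<le> p" "\<And>i. i \<in> I \<Longrightarrow> prob {\<omega> \<in> space M. i \<in> T \<omega>} \<le> p"
  shows "pearson_correlation (\<lambda>\<omega>. \<phi> (XX \<omega>)) (\<lambda>\<omega>. \<psi> (YY \<omega>)) \<le> sqrt p"
proof -
  define c v w where "c = covariance (\<lambda>\<omega>. \<phi> (XX \<omega>)) (\<lambda>\<omega>. \<psi> (YY \<omega>))"
    and "v = variance (\<lambda>\<omega>. \<phi> (XX \<omega>))" and "w = variance (\<lambda>\<omega>. \<psi> (YY \<omega>))"
  have pos: "v > 0" "w > 0"
    using \<phi> \<psi> by (auto simp: correlation_test_functions_def v_def w_def)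
  have "c\<^sup>2 \<le> v * (p * w)" unfolding c_def v_def w_def by (rule covariance_square_le) fact+
  then have "c \<le> sqrt (v * (p * w))" by (rule real_le_rsqrt)
  also have "\<dots> = sqrt p * (sqrt v * sqrt w)" by (simp add: real_sqrt_mult)
  finally have "c / (sqrt v * sqrt w) \<le> sqrt p" using pos by (simp add: divide_le_eq)
  then show ?thesis by (simp add: pearson_correlation_def c_def v_def w_def)
qed

section \<open>Attainment of the bound\<close>

text \<open>Take a centred bounded \<open>f\<close> of coordinate \<open>i\<close>, extended by 0 at
  the extra point for the masked side. With second moment \<sigma> of
  \<open>f (X i \<omega>)\<close> and \<open>p\<close> the probability of keeping \<open>i\<close>,
  the variances are \<sigma> and \<open>p * \<sigma>\<close> and the covariance is
  \<open>p * \<sigma>\<close>; the quotient is the root of \<open>p\<close>. Positivity of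
  \<open>p\<close> makes the masked function admissible.\<close>

lemma correlation_attained:
  assumes i: "i \<in> I" and nd: "\<not> degenerate F (X i)" and pos: "prob {\<omega> \<in> space M. i \<in> T \<omega>} > 0"
  shows "\<exists>\<phi> \<in> correlation_test_functions (\<Pi>\<^sub>M i\<in>I. F) XX.
    \<exists>\<psi> \<in> correlation_test_functions (\<Pi>\<^sub>M i\<in>I. adjoin_point F) YY.
    pearson_correlation (\<lambda>\<omega>. \<phi> (XX \<omega>)) (\<lambda>\<omega>. \<psi> (YY \<omega>)) = sqrt (prob {\<omega> \<in> space M. i \<in> T \<omega>})"
proof -
  let ?p = "prob {\<omega> \<in> space M. i \<in> T \<omega>}"
  obtain f :: "'b \<Rightarrow> real" and B where f[measurable]: "f \<in> borel_measurable F" and B: "\<And>x. \<bar>f x\<bar> \<le> B"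
    and mean: "expectation (\<lambda>\<omega>. f (X i \<omega>)) = 0" and f2: "expectation (\<lambda>\<omega>. (f (X i \<omega>))\<^sup>2) > 0"
    using not_degenerate_bounded_function[OF X_measurable[OF i] nd] by blast
  define \<phi> where "\<phi> x = f (x i)" for x :: "'i \<Rightarrow> 'b"
  define \<psi> where "\<psi> y = (case y i of None \<Rightarrow> 0 | Some u \<Rightarrow> f u)" for y :: "'i \<Rightarrow> 'b option"
  define \<sigma> where "\<sigma> = expectation (\<lambda>\<omega>. (f (X i \<omega>))\<^sup>2)"
  have [measurable]: "X i \<in> M \<rightarrow>\<^sub>M F" using i by simp
  have comp[measurable]: "(\<lambda>x. x i) \<in> (\<Pi>\<^sub>M i\<in>I. F) \<rightarrow>\<^sub>M F"
    using i by (rule measurable_component_singleton)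
  have \<phi>_meas: "\<phi> \<in> borel_measurable (\<Pi>\<^sub>M i\<in>I. F)" unfolding \<phi>_def[abs_def] by simp
  have \<psi>_meas: "\<psi> \<in> borel_measurable (\<Pi>\<^sub>M i\<in>I. adjoin_point F)"
  proof -
    have "(\<lambda>y. y i) \<in> (\<Pi>\<^sub>M i\<in>I. adjoin_point F) \<rightarrow>\<^sub>M adjoin_point F"
      using i by (rule measurable_component_singleton)
    from measurable_compose[OF this measurable_case_adjoin_point[OF f, of 0]]
    show ?thesis unfolding \<psi>_def[abs_def] by simp
  qed
  have \<phi>X: "\<phi> (XX \<omega>) = f (X i \<omega>)" for \<omega> using i by (simp add: \<phi>_def)
  have \<psi>Y: "\<psi> (YY \<omega>) = indicator (T \<omega>) i * f (X i \<omega>)" if "\<omega> \<in> space M" for \<omega>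
    using i that by (simp add: \<psi>_def Y_eq)
  \<comment> \<open>Masking multiplies the mean of a bounded function of \<open>X i\<close> by the
    probability of keeping \<open>i\<close>. It is applied to \<open>f\<close> for centring and to
    its square for the second moments.\<close>
  have thin: "expectation (\<lambda>\<omega>. indicator (T \<omega>) i * k (X i \<omega>)) = ?p * expectation (\<lambda>\<omega>. k (X i \<omega>))"
    "integrable M (\<lambda>\<omega>. indicator (T \<omega>) i * k (X i \<omega>))"
    if k[measurable]: "k \<in> borel_measurable F" and C: "\<And>x. \<bar>k x\<bar> \<le> C" for k :: "'b \<Rightarrow> real" and C
  proof -
    have ind_eq: "indicator (T \<omega>) i = (indicator {\<omega> \<in> space M. i \<in> T \<omega>} \<omega> :: real)" if "\<omega> \<in> space M" for \<omega>
      using that by (simp add: indicator_def)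
    have "(\<lambda>\<omega>. indicator (T \<omega>) i :: real) \<in> borel_measurable M"
      by (subst measurable_cong[OF ind_eq]) auto
    then have "(\<lambda>\<omega>. indicator (T \<omega>) i * k (X i \<omega>)) \<in> borel_measurable M" by simp
    moreover have "norm (indicator (T \<omega>) i * k (X i \<omega>)) \<le> C" for \<omega>
      using C[of "X i \<omega>"] by (auto simp: indicator_def)
    ultimately show int: "integrable M (\<lambda>\<omega>. indicator (T \<omega>) i * k (X i \<omega>))"
      by (intro integrable_const_bound[of _ C]) auto
    have "expectation (\<lambda>\<omega>. indicator (T \<omega>) i * k (XX \<omega> i))
      = (\<Sum>t\<in>Pow I. weight t * (\<integral>x. indicator t i * k (x i) \<partial>law))"
      by (rule integral_slices[of "\<lambda>t x. indicator t i * k (x i)"]) (use i int in auto)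
    also have "\<dots> = (\<Sum>t\<in>Pow I. if i \<in> t then weight t * (\<integral>x. k (x i) \<partial>law) else 0)"
      by (intro sum.cong) auto
    also have "\<dots> = ?p * (\<integral>x. k (x i) \<partial>law)"
      using finite_I by (subst sum.inter_filter[symmetric])
        (simp_all add: sum_weight[of "\<lambda>t. i \<in> t", simplified] flip: sum_distrib_right)
    also have "(\<integral>x. k (x i) \<partial>law) = expectation (\<lambda>\<omega>. k (X i \<omega>))"
      unfolding distr_XX[symmetric] using i by (subst integral_distr) auto
    finally show "expectation (\<lambda>\<omega>. indicator (T \<omega>) i * k (X i \<omega>)) = ?p * expectation (\<lambda>\<omega>. k (X i \<omega>))"
      using i by simp
  qed
  have B2: "\<bar>(f x)\<^sup>2\<bar> \<le> B\<^sup>2" for x using power_mono[OF B[of x], of 2] by simp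
  have mean_\<psi>: "expectation (\<lambda>\<omega>. \<psi> (YY \<omega>)) = 0"
  proof -
    have "expectation (\<lambda>\<omega>. \<psi> (YY \<omega>)) = expectation (\<lambda>\<omega>. indicator (T \<omega>) i * f (X i \<omega>))"
      by (intro Bochner_Integration.integral_cong) (auto simp: \<psi>Y)
    then show ?thesis using thin(1)[OF f B] mean by simp
  qed
  \<comment> \<open>An indicator is its own square, so the square of the masked function and the
    product of the two test functions coincide.\<close>
  have sq: "(\<psi> (YY \<omega>))\<^sup>2 = indicator (T \<omega>) i * (f (X i \<omega>))\<^sup>2"
    "\<phi> (XX \<omega>) * \<psi> (YY \<omega>) = indicator (T \<omega>) i * (f (X i \<omega>))\<^sup>2" if "\<omega> \<in> space M" for \<omega>
    using that by (auto simp: \<psi>Y \<phi>X indicator_def power2_eq_square)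
  have thin2: "expectation (\<lambda>\<omega>. indicator (T \<omega>) i * (f (X i \<omega>))\<^sup>2) = ?p * \<sigma>"
    "integrable M (\<lambda>\<omega>. indicator (T \<omega>) i * (f (X i \<omega>))\<^sup>2)"
    using thin[of "\<lambda>x. (f x)\<^sup>2", OF _ B2] by (auto simp: \<sigma>_def)
  have var_\<phi>: "variance (\<lambda>\<omega>. \<phi> (XX \<omega>)) = \<sigma>" by (simp add: \<phi>X mean \<sigma>_def)
  have "expectation (\<lambda>\<omega>. (\<psi> (YY \<omega>))\<^sup>2) = expectation (\<lambda>\<omega>. indicator (T \<omega>) i * (f (X i \<omega>))\<^sup>2)"
    by (intro Bochner_Integration.integral_cong) (auto simp: sq)
  then have var_\<psi>: "variance (\<lambda>\<omega>. \<psi> (YY \<omega>)) = ?p * \<sigma>" by (simp add: mean_\<psi> thin2)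
  have "expectation (\<lambda>\<omega>. \<phi> (XX \<omega>) * \<psi> (YY \<omega>)) = expectation (\<lambda>\<omega>. indicator (T \<omega>) i * (f (X i \<omega>))\<^sup>2)"
    by (intro Bochner_Integration.integral_cong) (auto simp: sq)
  then have cov: "covariance (\<lambda>\<omega>. \<phi> (XX \<omega>)) (\<lambda>\<omega>. \<psi> (YY \<omega>)) = ?p * \<sigma>"
    using mean by (simp add: covariance_def mean_\<psi> thin2 \<phi>X)
  have \<sigma>: "\<sigma> > 0" using f2 by (simp add: \<sigma>_def)
  have "integrable M (\<lambda>\<omega>. (\<phi> (XX \<omega>))\<^sup>2)"
    unfolding \<phi>X using B2 by (intro integrable_const_bound[of _ "B\<^sup>2"]) auto
  then have 1: "\<phi> \<in> correlation_test_functions (\<Pi>\<^sub>M i\<in>I. F) XX"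
    using \<phi>_meas \<sigma> unfolding correlation_test_functions_def mem_Collect_eq var_\<phi> by simp
  have "integrable M (\<lambda>\<omega>. (\<psi> (YY \<omega>))\<^sup>2)"
    by (subst Bochner_Integration.integrable_cong[OF refl sq(1)]) (use thin2 in auto)
  then have 2: "\<psi> \<in> correlation_test_functions (\<Pi>\<^sub>M i\<in>I. adjoin_point F) YY"
    using \<psi>_meas \<sigma> pos unfolding correlation_test_functions_def mem_Collect_eq var_\<psi> by simp
  have "sqrt \<sigma> * sqrt (?p * \<sigma>) = sqrt ?p * \<sigma>"
    using \<sigma> by (simp add: real_sqrt_mult)
  then have "?p * \<sigma> / (sqrt \<sigma> * sqrt (?p * \<sigma>)) = ?p * \<sigma> / (sqrt ?p * \<sigma>)"
    by simp
  also have "\<dots> = sqrt ?p" using \<sigma> pos by (simp add: real_div_sqrt)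
  finally have "pearson_correlation (\<lambda>\<omega>. \<phi> (XX \<omega>)) (\<lambda>\<omega>. \<psi> (YY \<omega>)) = sqrt ?p"
    unfolding pearson_correlation_def cov var_\<phi> var_\<psi> .
  with 1 2 show ?thesis by (intro bexI)
qed

text \<open>Finitely many null events have a null union, so \<open>T\<close> is almost surely empty
  and the masked vector is almost surely one fixed point.\<close>

lemma degenerate_YY:
  assumes "\<And>i. i \<in> I \<Longrightarrow> prob {\<omega> \<in> space M. i \<in> T \<omega>} = 0"
  shows "degenerate (\<Pi>\<^sub>M i\<in>I. adjoin_point F) YY"
proof -
  have "AE \<omega> in M. i \<notin> T \<omega>" if "i \<in> I" for i
    using assms[OF that] by (subst AE_iff_measurable[OF _ refl]) (auto simp: emeasure_eq_measure)
  then have "AE \<omega> in M. \<forall>i\<in>I. i \<notin> T \<omega>" by (simp add: AE_finite_all finite_I)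
  then have "AE \<omega> in M. YY \<omega> = (\<lambda>i\<in>I. None)"
    using AE_space by eventually_elim (auto simp: Y_eq fun_eq_iff)
  then have "AE \<omega> in M. f (YY \<omega>) = f (\<lambda>i\<in>I. None)" for f :: "_ \<Rightarrow> real"
    by eventually_elim simp
  then show ?thesis unfolding degenerate_def by blast
qed

theorem maximal_correlation_eq:
  assumes nd: "\<And>i. i \<in> I \<Longrightarrow> \<not> degenerate F (X i)"
  shows "maximal_correlation (\<Pi>\<^sub>M i\<in>I. F) XX (\<Pi>\<^sub>M i\<in>I. adjoin_point F) YY
    = sqrt (Max ((\<lambda>i. prob {\<omega> \<in> space M. i \<in> T \<omega>}) ` I))"
proof -
  let ?P = "\<lambda>i. prob {\<omega> \<in> space M. i \<in> T \<omega>}"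
  define p where "p = Max (?P ` I)"
  have P_le: "?P i \<le> p" if "i \<in> I" for i using that finite_I by (simp add: p_def)
  have "p \<in> ?P ` I" unfolding p_def using finite_I I_ne by (intro Max_in) auto
  then obtain i where i: "i \<in> I" "?P i = p" by auto
  show ?thesis
  proof (cases "p = 0")
    \<comment> \<open>All probabilities are zero here, and the convention that the coefficient is 0
      in the degenerate case agrees with the root of 0.\<close>
    case True
    have "?P j = 0" if "j \<in> I" for j
      using P_le[OF that] measure_nonneg[of M "{\<omega> \<in> space M. j \<in> T \<omega>}"] True by linarith
    then have "degenerate (\<Pi>\<^sub>M i\<in>I. adjoin_point F) YY" by (rule degenerate_YY)
    then show ?thesis using True by (simp add: maximal_correlation_def p_def)
  next
    case False
    then have p: "p > 0" using i by (metis measure_nonneg order_le_less)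
    obtain \<phi> \<psi> where tf: "\<phi> \<in> correlation_test_functions (\<Pi>\<^sub>M i\<in>I. F) XX"
        "\<psi> \<in> correlation_test_functions (\<Pi>\<^sub>M i\<in>I. adjoin_point F) YY"
      and eq: "pearson_correlation (\<lambda>\<omega>. \<phi> (XX \<omega>)) (\<lambda>\<omega>. \<psi> (YY \<omega>)) = sqrt p"
      using correlation_attained[OF i(1) nd[OF i(1)]] p unfolding i(2) by blast
    \<comment> \<open>The extremal pair itself certifies that neither vector is degenerate, so the
      supremum branch of the definition applies.\<close>
    have "\<not> degenerate (\<Pi>\<^sub>M i\<in>I. F) XX" "\<not> degenerate (\<Pi>\<^sub>M i\<in>I. adjoin_point F) YY"
      using not_degenerate_if_test_function[OF XX_measurable tf(1)]
        not_degenerate_if_test_function[OF YY_measurable tf(2)] by auto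
    then have "maximal_correlation (\<Pi>\<^sub>M i\<in>I. F) XX (\<Pi>\<^sub>M i\<in>I. adjoin_point F) YY
      = (SUP (\<phi>, \<psi>) \<in> correlation_test_functions (\<Pi>\<^sub>M i\<in>I. F) XX
            \<times> correlation_test_functions (\<Pi>\<^sub>M i\<in>I. adjoin_point F) YY.
          pearson_correlation (\<lambda>\<omega>. \<phi> (XX \<omega>)) (\<lambda>\<omega>. \<psi> (YY \<omega>)))"
      by (simp add: maximal_correlation_def)
    also have "\<dots> = sqrt p"
    \<comment> \<open>The bound is attained, so the supremum is a maximum and membership plus the
      upper bound suffice.\<close>
    proof (rule cSup_eq_maximum)
      show "sqrt p \<in> (\<lambda>(\<phi>, \<psi>). pearson_correlation (\<lambda>\<omega>. \<phi> (XX \<omega>)) (\<lambda>\<omega>. \<psi> (YY \<omega>)))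
        ` (correlation_test_functions (\<Pi>\<^sub>M i\<in>I. F) XX
            \<times> correlation_test_functions (\<Pi>\<^sub>M i\<in>I. adjoin_point F) YY)"
        using tf eq by (intro image_eqI[of _ _ "(\<phi>, \<psi>)"]) auto
    qed (use pearson_correlation_le[of _ _ p] p P_le in auto)
    finally show ?thesis by (simp add: p_def)
  qed
qed

end

theorem theorem1p4:
  fixes M :: "'w measure" and F :: "'b measure" and n :: nat
    and X :: "nat \<Rightarrow> 'w \<Rightarrow> 'b" and T :: "'w \<Rightarrow> nat set"
    and Y :: "nat \<Rightarrow> 'w \<Rightarrow> 'b option"
  assumes "prob_space M"
    and "n \<ge> 1"
    and "prob_space.indep_vars M (\<lambda>_. F) X {1..n}"
    and "\<And>i. i \<in> {1..n} \<Longrightarrow> \<not> prob_space.degenerate M F (X i)"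
    and "prob_space.indep_elements M
           (count_space (Pow {1..n})) T
           (\<Pi>\<^sub>M i\<in>{1..n}. F) (\<lambda>\<omega>. \<lambda>i\<in>{1..n}. X i \<omega>)"
    and "\<And>i \<omega>. i \<in> {1..n} \<Longrightarrow> \<omega> \<in> space M \<Longrightarrow>
           Y i \<omega> = (if i \<in> T \<omega> then Some (X i \<omega>) else None)"
  shows "prob_space.maximal_correlation M
           (\<Pi>\<^sub>M i\<in>{1..n}. F) (\<lambda>\<omega>. \<lambda>i\<in>{1..n}. X i \<omega>)
           (\<Pi>\<^sub>M i\<in>{1..n}. adjoin_point F) (\<lambda>\<omega>. \<lambda>i\<in>{1..n}. Y i \<omega>)
         = sqrt (Max ((\<lambda>i. measure M {\<omega> \<in> space M. i \<in> T \<omega>}) ` {1..n}))"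
proof -
  interpret prob_space M by fact
  \<comment> \<open>The assumption \<open>n \<ge> 1\<close> supplies the nonempty index set.\<close>
  interpret masked_vector M "{1..n}" F X T Y
    by unfold_locales (use assms in auto)
  show ?thesis by (rule maximal_correlation_eq) (rule assms(4))
qed

end
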